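(* $(\mathcal E,\mathcal V)$, with the star operation $^*:\mathcal E\to\mathcal E$ and the omega operation $^\omega:\mathcal E\to\mathcal V$, is a Conway semiring-semimodule pair.
   Context: Let $[0,\infty]_\bot=\{\bot\}\cup[0,\infty]$, totally ordered by the usual order with $\bot<x<\infty$ for $x\in[0,\infty)$. Conventions: $\bot\pm y=\bot$ and $\infty\pm y=\infty$ for real $y\ge 0$. An extended energy function is a map $f:[0,\infty]_\bot\to[0,\infty]_\bot$ with $f(\bot)=\bot$; $f(x_2)\ge f(x_1)+x_2-x_1$ for all real $0\le x_1\le x_2$; and $f(\infty)=\infty$, unless $f$ is constantly $\bot$; moreover, a function with $f(x)=\bot$ for all $x\in[0,\infty)$ is the constant $\bot$ function. $\mathcal E$ is the set of all extended energy functions. $f\vee g$ is the pointwise maximum, $gf=g\circ f$ is composition, $\bot\!\!\!\bot$ is the constant $\bot$ function and $\mathrm{id}$ the identity; $(\mathcal E,\vee,\circ,\bot\!\!\!\bot,\mathrm{id})$ is the semiring considered. The star of $f\in\mathcal E$ is $f^*(x)=x$ if $f(x)\le x$ and $f^*(x)=\infty$ if $f(x)>x$. Let $\mathcal B=\{\mathbf{ff},\mathbf{tt}\}$ with $\mathbf{ff}<\mathbf{tt}$. $\mathcal V$ is the set of monotone maps $u:[0,\infty]_\bot\to\mathcal B$ with $u(\bot)=\mathbf{ff}$, with pointwise join $\vee$, zero element the constant $\mathbf{ff}$ map, and right $\mathcal E$-action $(u,f)\mapsto uf=u\circ f$. The omega operation is: $f^\omega(x)=\mathbf{tt}$ if $x\ne\bot$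 and $f(x)\ge x$, and $f^\omega(x)=\mathbf{ff}$ if $x=\bot$ or $f(x)<x$. That $(\mathcal E,\mathcal V)$ is a Conway semiring-semimodule pair means: $\mathcal E$ is a semiring, $\mathcal V$ is a right $\mathcal E$-semimodule, and for all $f,g\in\mathcal E$, $$(g\vee f)^*=(g^*f)^*g^*,\qquad (gf)^*=g(fg)^*f\vee\mathrm{id},$$ $$(gf)^\omega=(fg)^\omega f,\qquad (f\vee g)^\omega=f^\omega(gf^* )^*\vee(gf^* )^\omega .$$ *)

theory Defs
  imports
    "HOL-Algebra.Ring"
    "HOL-Library.Extended_Nonnegative_Real"
    "HOL-Library.Option_ord"
begin

text \<open>
  The semimodule is a record of type \<^typ>\<open>('v, 'n) ring_scheme\<close> only because this is where the
  additive notation lives; its multiplicative fields are never used.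
\<close>

locale right_semimodule =
  R: semiring R + V: abelian_monoid V
  for R :: "('r, 'm) ring_scheme" (structure)
    and V :: "('v, 'n) ring_scheme" (structure) +
  fixes act :: "'v \<Rightarrow> 'r \<Rightarrow> 'v" (infixl \<open>\<cdot>\<close> 75)
  assumes act_closed:
      "\<lbrakk>u \<in> carrier V; f \<in> carrier R\<rbrakk> \<Longrightarrow> u \<cdot> f \<in> carrier V"
    and act_mult:
      "\<lbrakk>u \<in> carrier V; f \<in> carrier R; g \<in> carrier R\<rbrakk> \<Longrightarrow> u \<cdot> (f \<otimes>\<^bsub>R\<^esub> g) = (u \<cdot> f) \<cdot> g"
    and act_one:
      "u \<in> carrier V \<Longrightarrow> u \<cdot> \<one>\<^bsub>R\<^esub> = u"
    and act_add:
      "\<lbrakk>u \<in> carrier V; f \<in> carrier R; g \<in> carrier R\<rbrakk>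
        \<Longrightarrow> u \<cdot> (f \<oplus>\<^bsub>R\<^esub> g) = u \<cdot> f \<oplus>\<^bsub>V\<^esub> u \<cdot> g"
    and add_act:
      "\<lbrakk>u \<in> carrier V; v \<in> carrier V; f \<in> carrier R\<rbrakk>
        \<Longrightarrow> (u \<oplus>\<^bsub>V\<^esub> v) \<cdot> f = u \<cdot> f \<oplus>\<^bsub>V\<^esub> v \<cdot> f"
    and act_zero:
      "u \<in> carrier V \<Longrightarrow> u \<cdot> \<zero>\<^bsub>R\<^esub> = \<zero>\<^bsub>V\<^esub>"
    and zero_act:
      "f \<in> carrier R \<Longrightarrow> \<zero>\<^bsub>V\<^esub> \<cdot> f = \<zero>\<^bsub>V\<^esub>"

locale conway_semiring_semimodule_pair = right_semimodule R V act
  for R :: "('r, 'm) ring_scheme" (structure)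
    and V :: "('v, 'n) ring_scheme" (structure)
    and act :: "'v \<Rightarrow> 'r \<Rightarrow> 'v" (infixl \<open>\<cdot>\<close> 75) +
  fixes star :: "'r \<Rightarrow> 'r"
    and omega :: "'r \<Rightarrow> 'v"
  assumes star_closed: "f \<in> carrier R \<Longrightarrow> star f \<in> carrier R"
    and omega_closed: "f \<in> carrier R \<Longrightarrow> omega f \<in> carrier V"
    and star_sum:
      "\<lbrakk>f \<in> carrier R; g \<in> carrier R\<rbrakk>
        \<Longrightarrow> star (g \<oplus>\<^bsub>R\<^esub> f) = star (star g \<otimes>\<^bsub>R\<^esub> f) \<otimes>\<^bsub>R\<^esub> star g"
    and star_product:
      "\<lbrakk>f \<in> carrier R; g \<in> carrier R\<rbrakk>
        \<Longrightarrow> star (g \<otimes>\<^bsub>R\<^esub> f) = g \<otimes>\<^bsub>R\<^esub> star (f \<otimes>\<^bsub>R\<^esub> g) \<otimes>\<^bsub>R\<^esub> f \<oplus>\<^bsub>R\<^esub> \<one>\<^bsub>R\<^esub>"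
    and omega_product:
      "\<lbrakk>f \<in> carrier R; g \<in> carrier R\<rbrakk>
        \<Longrightarrow> omega (g \<otimes>\<^bsub>R\<^esub> f) = omega (f \<otimes>\<^bsub>R\<^esub> g) \<cdot> f"
    and omega_sum:
      "\<lbrakk>f \<in> carrier R; g \<in> carrier R\<rbrakk>
        \<Longrightarrow> omega (f \<oplus>\<^bsub>R\<^esub> g)
          = omega f \<cdot> star (g \<otimes>\<^bsub>R\<^esub> star f) \<oplus>\<^bsub>V\<^esub> omega (g \<otimes>\<^bsub>R\<^esub> star f)"

text \<open>
  The bottom element is \<^term>\<open>None\<close>; the order on \<^typ>\<open>'a option\<close> puts it below
  everything else.
\<close>

type_synonym energy = "ennreal option"

text \<open>
  In the growth condition, \<^const>\<open>map_option\<close> implements the convention that bottom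
  absorbs addition and subtraction of reals; infinity absorbs them in \<^typ>\<open>ennreal\<close>
  already. The subtraction is never truncated, since \<open>x1 \<le> x2\<close>.
\<close>

definition energy_function :: "(energy \<Rightarrow> energy) \<Rightarrow> bool" where
  "energy_function f \<longleftrightarrow>
     f None = None \<and>
     (\<forall>x1 x2 :: real. 0 \<le> x1 \<and> x1 \<le> x2 \<longrightarrow>
        f (Some (ennreal x2)) \<ge>
          map_option (\<lambda>y. y + ennreal x2 - ennreal x1) (f (Some (ennreal x1)))) \<and>
     (f \<noteq> (\<lambda>_. None) \<longrightarrow> f (Some \<infinity>) = Some \<infinity>) \<and>
     ((\<forall>x :: real. 0 \<le> x \<longrightarrow> f (Some (ennreal x)) = None) \<longrightarrow> f = (\<lambda>_. None))"

definition energy_semiring :: "(energy \<Rightarrow> energy) ring" where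
  "energy_semiring =
     \<lparr>carrier = {f. energy_function f},
      monoid.mult = (\<lambda>g f. g \<circ> f),
      one = id,
      zero = (\<lambda>_. None),
      add = (\<lambda>f g x. max (f x) (g x))\<rparr>"

definition energy_star :: "(energy \<Rightarrow> energy) \<Rightarrow> energy \<Rightarrow> energy" where
  "energy_star f x = (if f x \<le> x then x else Some \<infinity>)"

definition energy_semimodule :: "(energy \<Rightarrow> bool) ring" where
  "energy_semimodule =
     \<lparr>carrier = {u. mono u \<and> \<not> u None},
      monoid.mult = undefined,
      one = undefined,
      zero = (\<lambda>_. False),
      add = (\<lambda>u v x. u x \<or> v x)\<rparr>"

definition energy_action :: "(energy \<Rightarrow> bool) \<Rightarrow> (energy \<Rightarrow> energy) \<Rightarrow> energy \<Rightarrow> bool" where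
  "energy_action u f = u \<circ> f"

definition energy_omega :: "(energy \<Rightarrow> energy) \<Rightarrow> energy \<Rightarrow> bool" where
  "energy_omega f x \<longleftrightarrow> x \<noteq> None \<and> f x \<ge> x"

end

theory Submission
  imports Defs
begin

text \<open>
  Growth at slope at least one, which also holds with infinite increments, makes every energy
  function monotone and, where its value is finite, strictly monotone. It also propagates
  \<open>x \<le> f x\<close> to larger arguments, and \<open>x < f x\<close> to larger
  finite arguments. As \<open>f\<^sup>*\<close> takes only the values \<open>x\<close> and infinity at
  \<open>x\<close>, each Conway identity reduces to comparing
  \<open>f x\<close> and \<open>g x\<close> with \<open>x\<close>.
\<close>

section \<open>Growth by arbitrary increments and a membership criterion\<close>

hide_const (open) Order.top

text \<open>If \<open>x + d\<close> is finite, so are \<open>x\<close> and \<open>d\<close>, and the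
  growth condition over the reals applies. Otherwise \<open>f\<close>, not being constantly bottom,
  sends infinity to itself.\<close>

lemma energy_growth:
  assumes f: "energy_function f" and fx: "f (Some x) = Some y"
  shows "Some (y + d) \<le> f (Some (x + d))"
proof (cases "x + d = top")
  case True
  have "f \<noteq> (\<lambda>_. None)" using fx by auto
  then have "f (Some top) = Some top"
    using f by (auto simp: energy_function_def)
  then show ?thesis unfolding True by simp
next
  case False
  then obtain a b where a: "x = ennreal a" "0 \<le> a" and b: "d = ennreal b" "0 \<le> b"
    by (cases x; cases d) auto
  have "map_option (\<lambda>y. y + ennreal (a + b) - ennreal a) (f (Some (ennreal a)))
      \<le> f (Some (ennreal (a + b)))"
    using f[unfolded energy_function_def, THEN conjunct2, THEN conjunct1, rule_format, of a "a + b"]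
      \<open>0 \<le> a\<close> \<open>0 \<le> b\<close> by linarith
  \<comment> \<open>The sum is rearranged to \<open>a + (y + b)\<close> because only the finite
    \<open>a\<close> can be cancelled; \<open>y\<close> may be infinite.\<close>
  moreover have "y + ennreal (a + b) - ennreal a = y + d"
    using a b by (simp add: add.left_commute[of y] ennreal_add_diff_cancel_left)
  moreover have "ennreal (a + b) = x + d"
    using a b by simp
  ultimately show ?thesis using fx a(1) by simp
qed

text \<open>Converse of \<open>energy_growth\<close>, for the closure proofs: finite increments give
  the growth condition, an infinite one the value at infinity. The premise \<open>finite\<close>
  rules out functions that leave bottom only at infinity.\<close>

lemma energy_functionI:
  assumes "f None = None"
    and growth: "\<And>x y d. f (Some x) = Some y \<Longrightarrow> Some (y + d) \<le> f (Some (x + d))"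
    and finite: "\<And>x y. f (Some x) = Some y \<Longrightarrow> \<exists>x'. x' \<noteq> top \<and> f (Some x') \<noteq> None"
  shows "energy_function f"
  unfolding energy_function_def
proof (intro conjI allI impI)
  fix a b :: real
  assume ab: "0 \<le> a \<and> a \<le> b"
  show "map_option (\<lambda>y. y + ennreal b - ennreal a) (f (Some (ennreal a))) \<le> f (Some (ennreal b))"
  proof (cases "f (Some (ennreal a))")
    case (Some y)
    have b: "ennreal b = ennreal a + ennreal (b - a)"
      using ab by (simp flip: ennreal_plus)
    then have "y + ennreal b - ennreal a = y + ennreal (b - a)"
      by (metis add.left_commute ennreal_add_diff_cancel_left ennreal_neq_top)
    then show ?thesis using growth[OF Some, of "ennreal (b - a)"] Some b by simp
  qed simp
next
  assume "f \<noteq> (\<lambda>_. None)"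
  then obtain x y where "f (Some x) = Some y"
    using assms(1) by (metis not_None_eq)
  from growth[OF this, of top] show "f (Some \<infinity>) = Some \<infinity>"
    by (cases "f (Some top)") (auto simp: top_unique)
next
  assume bot: "\<forall>x::real. 0 \<le> x \<longrightarrow> f (Some (ennreal x)) = None"
  show "f = (\<lambda>_. None)"
  proof (rule ccontr)
    assume "f \<noteq> (\<lambda>_. None)"
    then obtain x y where "f (Some x) = Some y"
      using assms(1) by (metis not_None_eq)
    then obtain x' where "x' \<noteq> top" "f (Some x') \<noteq> None"
      using finite by blast
    then show False using bot by (metis ennreal_cases)
  qed
qed (fact assms(1))

section \<open>Bottom, infinity and monotonicity\<close>

lemma energy_None: "energy_function f \<Longrightarrow> f None = None"
  by (simp add: energy_function_def)

lemma energy_top: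
  assumes "energy_function f" "f x \<noteq> None"
  shows "f (Some top) = Some top"
  using assms unfolding energy_function_def by auto

lemma energy_finite:
  assumes "energy_function f" "f x \<noteq> None"
  obtains x' where "x' \<noteq> top" "f (Some x') \<noteq> None"
proof -
  have "f \<noteq> (\<lambda>_. None)" using assms(2) by auto
  then show ?thesis
    using assms(1) that unfolding energy_function_def by (metis ennreal_neq_top)
qed

text \<open>Turns an order relation into an increment, so that \<open>energy_growth\<close> applies;
  \<open>d\<close> is infinite if \<open>x\<close> is finite and \<open>z\<close> is
  infinite.\<close>

lemma Some_le_imp_add:
  fixes x :: ennreal
  assumes "Some x \<le> z"
  obtains d where "z = Some (x + d)"
  using assms by (cases z) (auto simp: le_iff_add)

lemma Some_top_greatest: "z \<le> Some (top :: ennreal)"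
  by (cases z) auto

lemma Some_top_le_iff: "Some (top :: ennreal) \<le> z \<longleftrightarrow> z = Some top"
  by (cases z) (auto simp: top_unique)

lemma energy_mono:
  assumes f: "energy_function f" and "x \<le> y"
  shows "f x \<le> f y"
proof (cases "f x")
  case (Some b)
  then obtain a where a: "x = Some a" using energy_None[OF f] by (cases x) auto
  then obtain d where d: "y = Some (a + d)" using Some_le_imp_add assms(2) by metis
  have "Some b \<le> Some (b + d)" by simp
  also have "\<dots> \<le> f y" using energy_growth[OF f] Some a d by simp
  finally show ?thesis using Some by simp
qed simp

lemma energy_max: "energy_function f \<Longrightarrow> f (max x y) = max (f x) (f y)"
  by (rule max_of_mono[symmetric]) (auto intro: monoI energy_mono)

text \<open>The increment of the argument is nonzero, so it strictly increases the finite value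
  \<open>b\<close>; an infinite value would absorb it.\<close>

lemma energy_strict_mono:
  assumes f: "energy_function f" and "x < y" and fin: "f x \<noteq> None" "f x \<noteq> Some top"
  shows "f x < f y"
proof -
  obtain b where b: "f x = Some b" "b \<noteq> top" using fin by auto
  then obtain a where a: "x = Some a" using energy_None[OF f] by (cases x) auto
  then obtain d where d: "y = Some (a + d)" using Some_le_imp_add assms(2) by (metis order.strict_implies_order)
  have "d \<noteq> 0" using assms(2) a d by auto
  then have "b < b + d" using b(2) by (simp add: less_top zero_less_iff_neq_zero)
  then have "Some b < Some (b + d)" by simp
  also have "\<dots> \<le> f y" using energy_growth[OF f] b a d by simp
  finally show ?thesis using b by simp
qed

text \<open>Adding \<open>d\<close> to both sides of \<open>a \<le> b\<close> keeps the inequality,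
  even for infinite \<open>d\<close>. Bottom is excluded because every energy function fixes
  it.\<close>

lemma energy_ge_mono:
  assumes f: "energy_function f" and "x \<noteq> None" "x \<le> f x" "x \<le> y"
  shows "y \<le> f y"
proof -
  obtain a where a: "x = Some a" using assms(2) by auto
  then obtain b where b: "f x = Some b" "a \<le> b" using assms(3) by (cases "f x") auto
  obtain d where d: "y = Some (a + d)" using Some_le_imp_add a assms(4) by metis
  have "y \<le> Some (b + d)" using b d by (simp add: add_right_mono)
  also have "\<dots> \<le> f y" using energy_growth[OF f] b a d by simp
  finally show ?thesis .
qed

text \<open>A finite increment keeps \<open>a < b\<close> strict, and \<open>d\<close> is finite
  because \<open>y\<close> is not infinity. Bottom is excluded by \<open>x < f x\<close>
  itself.\<close>

lemma energy_gt_mono: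
  assumes f: "energy_function f" and "x < f x" "x \<le> y" "y \<noteq> Some top"
  shows "y < f y"
proof -
  obtain a where a: "x = Some a" using assms(2) energy_None[OF f] by (cases x) auto
  then obtain b where b: "f x = Some b" "a < b" using assms(2) by (cases "f x") auto
  obtain d where d: "y = Some (a + d)" using Some_le_imp_add a assms(3) by metis
  have "d \<noteq> top" using assms(4) d by auto
  then have "y < Some (b + d)" using b d
    by (simp add: ennreal_add_left_cancel_less add.commute[of _ d] less_top)
  also have "\<dots> \<le> f y" using energy_growth[OF f] b a d by simp
  finally show ?thesis .
qed

section \<open>Closure under identity, zero, join and composition\<close>

lemma energy_function_id: "energy_function id"
  by (rule energy_functionI) (auto intro: exI[of _ 0])

lemma energy_function_bot: "energy_function (\<lambda>_. None)"
  by (rule energy_functionI) auto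

lemma energy_function_max:
  assumes f: "energy_function f" and g: "energy_function g"
  shows "energy_function (\<lambda>x. max (f x) (g x))"
proof (rule energy_functionI)
  show "max (f None) (g None) = None" using f g by (simp add: energy_None)
next
  fix x y d
  assume "max (f (Some x)) (g (Some x)) = Some y"
  then have "f (Some x) = Some y \<or> g (Some x) = Some y" by (auto simp: max_def split: if_splits)
  then show "Some (y + d) \<le> max (f (Some (x + d))) (g (Some (x + d)))"
    using energy_growth[OF f] energy_growth[OF g] by (auto simp: le_max_iff_disj)
next
  fix x y
  assume "max (f (Some x)) (g (Some x)) = Some y"
  then consider "f (Some x) \<noteq> None" | "g (Some x) \<noteq> None" by (auto simp: max_def split: if_splits)
  then obtain x' where x': "x' \<noteq> top" "f (Some x') \<noteq> None \<or> g (Some x') \<noteq> None"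
    by cases (metis energy_finite f g)+
  then have "max (f (Some x')) (g (Some x')) \<noteq> None"
    by (metis less_eq_option_None_is_None max.cobounded1 max.cobounded2)
  with x' show "\<exists>x'. x' \<noteq> top \<and> max (f (Some x')) (g (Some x')) \<noteq> None" by blast
qed

lemma energy_function_comp:
  assumes f: "energy_function f" and g: "energy_function g"
  shows "energy_function (g \<circ> f)"
proof (rule energy_functionI)
  show "(g \<circ> f) None = None" using f g by (simp add: energy_None)
next
  fix x y d
  assume gfx: "(g \<circ> f) (Some x) = Some y"
  then obtain z where z: "f (Some x) = Some z" using energy_None[OF g] by (cases "f (Some x)") auto
  have "Some (y + d) \<le> g (Some (z + d))" using energy_growth[OF g] gfx z by simp
  also have "\<dots> \<le> g (f (Some (x + d)))"
    by (rule energy_mono[OF g energy_growth[OF f z]])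
  finally show "Some (y + d) \<le> (g \<circ> f) (Some (x + d))" by simp
next
  fix x y
  assume gfx: "(g \<circ> f) (Some x) = Some y"
  \<comment> \<open>The witness is \<open>a + z\<close>, where \<open>f\<close> is not bottom at the
    finite \<open>a\<close> and \<open>g\<close> is not bottom at the finite \<open>z\<close>:
    growth lifts \<open>f\<close> to at least \<open>z\<close> there, and \<open>g\<close> is
    monotone.\<close>
  then obtain z where z: "z \<noteq> top" "g (Some z) \<noteq> None" using energy_finite[OF g, of "f (Some x)"] by auto
  have "f (Some x) \<noteq> None" using gfx energy_None[OF g] by (metis comp_apply option.distinct(1))
  then obtain a b where a: "a \<noteq> top" "f (Some a) = Some b" using energy_finite[OF f] by (metis not_None_eq)
  have "Some z \<le> Some (b + z)" by simp
  also have "\<dots> \<le> f (Some (a + z))" by (rule energy_growth[OF f a(2)])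
  finally have "g (Some z) \<le> g (f (Some (a + z)))" by (rule energy_mono[OF g])
  then have "(g \<circ> f) (Some (a + z)) \<noteq> None" using z by (metis comp_apply less_eq_option_None_is_None)
  moreover have "a + z \<noteq> top" using a z by simp
  ultimately show "\<exists>x'. x' \<noteq> top \<and> (g \<circ> f) (Some x') \<noteq> None" by blast
qed

section \<open>The star and omega operations\<close>

lemma energy_star_le: "f x \<le> x \<Longrightarrow> energy_star f x = x"
  and energy_star_gt: "x < f x \<Longrightarrow> energy_star f x = Some top"
  by (auto simp: energy_star_def)

lemma energy_star_ge: "x \<le> energy_star f x"
  by (simp add: energy_star_def Some_top_greatest)

lemma energy_star_top: "energy_star f (Some top) = Some top"
  by (simp add: energy_star_def)

text \<open>Once \<open>f\<close> raises \<open>x\<close>, by \<open>energy_gt_mono\<close> it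
  raises every larger finite argument, so the star stays infinite; where the star fixes
  \<open>x\<close>, \<open>energy_star_ge\<close> suffices. At \<open>0\<close> the star is never
  bottom.\<close>

lemma energy_function_star:
  assumes f: "energy_function f"
  shows "energy_function (energy_star f)"
proof (rule energy_functionI)
  show "energy_star f None = None" using f by (simp add: energy_star_def energy_None)
next
  fix x y d
  assume y: "energy_star f (Some x) = Some y"
  show "Some (y + d) \<le> energy_star f (Some (x + d))"
  proof (cases "f (Some x) \<le> Some x")
    case True
    then show ?thesis using y energy_star_ge by (auto simp: energy_star_le)
  next
    case False
    have "energy_star f (Some (x + d)) = Some top"
    proof (cases "x + d = top")
      case fin: False
      then have "Some (x + d) < f (Some (x + d))"
        using energy_gt_mono[OF f, of "Some x" "Some (x + d)"] False by simp
      then show ?thesis by (rule energy_star_gt)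
    qed (simp only: energy_star_top)
    then show ?thesis by (simp add: Some_top_greatest)
  qed
next
  show "\<exists>x'. x' \<noteq> top \<and> energy_star f (Some x') \<noteq> None"
    by (rule exI[of _ 0]) (simp add: energy_star_def)
qed

text \<open>Upward closure is \<open>energy_ge_mono\<close>; it places the omega in the
  semimodule.\<close>

lemma mono_energy_omega: "energy_function f \<Longrightarrow> mono (energy_omega f)"
  by (intro monoI le_boolI) (metis energy_omega_def energy_ge_mono less_eq_option_None_is_None)

section \<open>The four Conway identities\<close>

text \<open>The outer star keeps an infinite value of \<open>energy_star g\<close>. Where
  \<open>energy_star g\<close> fixes \<open>x\<close>, the value \<open>energy_star g (f x)\<close>
  exceeds \<open>x\<close> exactly when \<open>f x\<close> does.\<close>

lemma energy_star_sum:
  assumes f: "energy_function f" and g: "energy_function g"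
  shows "energy_star (\<lambda>x. max (g x) (f x)) = energy_star (energy_star g \<circ> f) \<circ> energy_star g"
proof
  fix x
  consider "x < g x" | "g x \<le> x" "x < f x" | "g x \<le> x" "f x \<le> x" by fastforce
  then show "energy_star (\<lambda>x. max (g x) (f x)) x = (energy_star (energy_star g \<circ> f) \<circ> energy_star g) x"
  proof cases
    case 1
    then show ?thesis by (simp add: energy_star_gt energy_star_top less_max_iff_disj)
  next
    case 2
    moreover have "x < energy_star g (f x)" using 2(2) energy_star_ge by (rule less_le_trans)
    ultimately show ?thesis by (simp add: energy_star_le energy_star_gt less_max_iff_disj)
  next
    case 3
    have "energy_star g (f x) \<le> x"
    proof (cases "x = Some top")
      case False
      \<comment> \<open>If \<open>g\<close> raised \<open>f x\<close>, it would also raise the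
        larger \<open>x\<close>, which is not infinity.\<close>
      then have "g (f x) \<le> f x" using energy_gt_mono[OF g _ 3(2)] 3(1) by (meson not_less)
      then show ?thesis using 3 by (simp add: energy_star_le)
    qed (simp add: Some_top_greatest)
    then show ?thesis using 3 by (simp add: energy_star_le)
  qed
qed

text \<open>Applying \<open>f\<close> to \<open>g (f x) \<le> x\<close> shows that the right-hand
  star fixes \<open>f x\<close>. If \<open>x < g (f x)\<close>, strict monotonicity of
  \<open>f\<close> makes that star infinite at \<open>f x\<close>, and \<open>g\<close> preserves
  infinity.\<close>

lemma energy_star_product:
  assumes f: "energy_function f" and g: "energy_function g"
  shows "energy_star (g \<circ> f) = (\<lambda>x. max ((g \<circ> energy_star (f \<circ> g) \<circ> f) x) (id x))"
proof
  fix x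
  show "energy_star (g \<circ> f) x = max ((g \<circ> energy_star (f \<circ> g) \<circ> f) x) (id x)"
  proof (cases "g (f x) \<le> x")
    case True
    then have "f (g (f x)) \<le> f x" by (rule energy_mono[OF f])
    then show ?thesis using True by (simp add: energy_star_le max_absorb2)
  next
    case False
    then have gt: "x < g (f x)" by simp
    then have top: "g (Some top) = Some top" by (intro energy_top[OF g, of "f x"]) (metis less_option_None)
    have "energy_star (f \<circ> g) (f x) = Some top"
    \<comment> \<open>Strict monotonicity needs a finite value; at infinity the star is infinite
      anyway.\<close>
    proof (cases "f x = Some top")
      case False
      moreover have "f x \<noteq> None" using gt energy_None[OF g] by (metis less_option_None)
      ultimately have "f x < f (g (f x))" using energy_strict_mono[OF f gt] by blast
      then show ?thesis by (simp add: energy_star_gt)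
    qed (simp add: energy_star_top)
    then show ?thesis using gt top by (simp add: energy_star_gt max_absorb1 Some_top_greatest)
  qed
qed

text \<open>Forwards, apply the monotone \<open>f\<close>. Backwards, \<open>g (f x) < x\<close>
  would give \<open>f (g (f x)) < f x\<close> by strict monotonicity, unless infinity
  intervenes.\<close>

lemma energy_omega_product:
  assumes f: "energy_function f" and g: "energy_function g"
  shows "energy_omega (g \<circ> f) = energy_omega (f \<circ> g) \<circ> f"
proof
  fix x
  have "(x \<noteq> None \<and> x \<le> g (f x)) \<longleftrightarrow> (f x \<noteq> None \<and> f x \<le> f (g (f x)))"
  proof (intro iffI conjI; elim conjE)
    assume "x \<noteq> None" "x \<le> g (f x)"
    then show "f x \<noteq> None" using energy_None[OF g] by (metis less_eq_option_None_is_None)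
    show "f x \<le> f (g (f x))" using \<open>x \<le> g (f x)\<close> by (rule energy_mono[OF f])
  next
    assume "f x \<noteq> None"
    then show "x \<noteq> None" using energy_None[OF f] by metis
  next
    assume fx: "f x \<noteq> None" "f x \<le> f (g (f x))"
    show "x \<le> g (f x)"
    proof (rule ccontr)
      assume "\<not> x \<le> g (f x)"
      then have less: "g (f x) < x" by simp
      have nbot: "f (g (f x)) \<noteq> None" using fx by (metis less_eq_option_None_is_None)
      then have g_nbot: "g (f x) \<noteq> None" using energy_None[OF f] by metis
      show False
      proof (cases "f (g (f x)) = Some top")
        \<comment> \<open>Infinity passes from \<open>f (g (f x))\<close> up to \<open>f x\<close>
          and, through \<open>g\<close>, to \<open>g (f x)\<close>, which then cannot lie below
          \<open>x\<close>.\<close>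
        case True
        then have "f x = Some top"
          using energy_mono[OF f less_imp_le[OF less]] by (simp add: Some_top_le_iff)
        then have "g (f x) = Some top" using energy_top[OF g g_nbot] by simp
        then show False using less Some_top_greatest[of x] by simp
      next
        case False
        then show False using energy_strict_mono[OF f less nbot] fx by simp
      qed
    qed
  qed
  then show "energy_omega (g \<circ> f) x = (energy_omega (f \<circ> g) \<circ> f) x"
    by (simp add: energy_omega_def)
qed

text \<open>Where \<open>energy_omega f\<close> holds it still holds after the star, which only
  moves \<open>x\<close> upwards. Elsewhere \<open>energy_star f\<close> fixes \<open>x\<close>, and
  only \<open>g x\<close> versus \<open>x\<close> matters.\<close>

lemma energy_omega_sum:
  assumes f: "energy_function f" and g: "energy_function g"
  shows "energy_omega (\<lambda>x. max (f x) (g x))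
    = (\<lambda>x. (energy_omega f \<circ> energy_star (g \<circ> energy_star f)) x \<or> energy_omega (g \<circ> energy_star f) x)"
proof
  fix x
  show "energy_omega (\<lambda>x. max (f x) (g x)) x
    = ((energy_omega f \<circ> energy_star (g \<circ> energy_star f)) x \<or> energy_omega (g \<circ> energy_star f) x)"
  proof (cases "x \<noteq> None \<and> x \<le> f x")
    case True
    then have "energy_omega f x" by (simp add: energy_omega_def)
    then have "energy_omega f (energy_star (g \<circ> energy_star f) x)"
      using monoD[OF mono_energy_omega[OF f] energy_star_ge] by (simp add: le_bool_def)
    then show ?thesis using True by (simp add: energy_omega_def le_max_iff_disj)
  next
    case False
    \<comment> \<open>Bottom is a fixed point; at other points linearity of the order
      applies.\<close>
    then have "f x \<le> x" using energy_None[OF f] by (cases "x = None") auto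
    then have star: "energy_star f x = x" by (rule energy_star_le)
    show ?thesis
    proof (cases "g x \<le> x")
      case True
      then show ?thesis using False star
        by (auto simp: energy_omega_def energy_star_le le_max_iff_disj)
    next
      assume "\<not> g x \<le> x"
      then have "x < g x" by simp
      then have "x \<noteq> None" using energy_None[OF g] by (metis less_option_None)
      with \<open>x < g x\<close> have "energy_omega (g \<circ> energy_star f) x" "energy_omega (\<lambda>x. max (f x) (g x)) x"
        using star by (auto simp: energy_omega_def le_max_iff_disj simp del: not_None_eq)
      then show ?thesis by simp
    qed
  qed
qed

section \<open>Semiring, semimodule and pair\<close>

text \<open>Beyond closure, two facts about energy functions enter: \<open>energy_max\<close> gives
  distributivity with the join as inner factor, and \<open>energy_None\<close> makes zero absorbing
  there.\<close>

lemma semiring_energy: "semiring energy_semiring"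
  by (intro semiring.intro abelian_monoidI monoidI semiring_axioms.intro)
    (simp_all add: energy_semiring_def energy_function_max energy_function_comp energy_function_id
      energy_function_bot energy_None energy_max comp_assoc fun_eq_iff ac_simps)

lemma abelian_monoid_energy_semimodule: "abelian_monoid energy_semimodule"
  by (rule abelian_monoidI) (auto simp: energy_semimodule_def mono_def le_bool_def fun_eq_iff)

lemma right_semimodule_energy:
  "right_semimodule energy_semiring energy_semimodule energy_action"
proof (intro right_semimodule.intro semiring_energy abelian_monoid_energy_semimodule
    right_semimodule_axioms.intro)
  fix u f g
  assume u: "u \<in> carrier energy_semimodule"
    and f: "f \<in> carrier energy_semiring" and g: "g \<in> carrier energy_semiring"
  \<comment> \<open>On a linear order a monotone Boolean map turns \<open>max\<close> into
    disjunction, so the action distributes over joins of energy functions.\<close>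
  have "mono u" using u by (simp add: energy_semimodule_def)
  then have "u (max a b) = (u a \<or> u b)" for a b
    by (cases a b rule: linorder_le_cases) (auto simp: max_def mono_def le_bool_def)
  then show "energy_action u (f \<oplus>\<^bsub>energy_semiring\<^esub> g)
      = energy_action u f \<oplus>\<^bsub>energy_semimodule\<^esub> energy_action u g"
    by (simp add: energy_action_def energy_semiring_def energy_semimodule_def fun_eq_iff)
next
  fix u f
  assume "u \<in> carrier energy_semimodule" "f \<in> carrier energy_semiring"
  then have u: "mono u" "\<not> u None" and f: "energy_function f"
    by (simp_all add: energy_semiring_def energy_semimodule_def)
  have "mono (u \<circ> f)"
    by (intro monoI) (simp only: comp_apply monoD[OF u(1) energy_mono[OF f]])
  then show "energy_action u f \<in> carrier energy_semimodule"
    using u f by (simp add: energy_action_def energy_semimodule_def energy_None)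
qed (simp_all add: energy_action_def energy_semiring_def energy_semimodule_def fun_eq_iff)

theorem proposition2:
  shows "conway_semiring_semimodule_pair energy_semiring energy_semimodule energy_action
           energy_star energy_omega"
proof (intro conway_semiring_semimodule_pair.intro right_semimodule_energy
    conway_semiring_semimodule_pair_axioms.intro)
\<comment> \<open>Only the record operations are unfolded, so that the remaining identities keep the
  exact form of the lemmas above.\<close>
qed (simp_all only: energy_semiring_def energy_semimodule_def energy_action_def ring.simps
    ring.select_convs monoid.simps partial_object.simps mem_Collect_eq,
  fact energy_function_star, simp add: mono_energy_omega energy_omega_def,
  fact energy_star_sum, fact energy_star_product, fact energy_omega_product, fact energy_omega_sum)

end
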